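(* Let $\bar{x}\in\Omega$ and suppose $\mathbb{B}(0;L)\subseteq\mathcal{U}_i$ for all $i\in I$, for some $L>0$, where $\mathbb{B}(0;L)$ is the open ball of $X^*$ centered at $0$ with radius $L$. (i) If $\bar{x}$ is an isolated efficient solution of the problem $\min f(x)$ s.t. $x\in\Omega$ with constant $L$, then $\bar{x}$ is a highly robust strictly efficient solution of $(P_{\bar{\mathcal{U}}})$, where $\bar{\mathcal{U}}=\prod_{i=1}^p\bar{\mathcal{U}}_i$ and $\bar{\mathcal{U}}_i:=\mathbb{B}(0;L)$, $i\in I$. (ii) If $X$ is a (reflexive) Hilbert space and $\bar{x}$ is a highly robust weakly efficient solution of $(P_{\mathcal{U}})$, then $\bar{x}$ is an isolated efficient solution of the problem $\min f(x)$ s.t. $x\in\Omega$ with any constant $\bar L\in(0,L)$.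
   Context: Setting: $X$ is a real Banach space with dual $X^*$ and pairing $\langle\cdot,\cdot\rangle$; $p\ge 2$, $I=\{1,\dots,p\}$; $f=(f_1,\dots,f_p):X\to\mathbb{R}^p$; $\Omega\subseteq X$ is nonempty (the robust feasible set); $\mathcal{U}_i\subseteq X^*$, $i\in I$, are nonempty and $\mathcal{U}=\prod_{i=1}^p\mathcal{U}_i$. For $u\in (X^* )^p$ put $f_i(x,u_i)=f_i(x)-\langle u_i,x\rangle$ and $f(x,u)=(f_1(x,u_1),\dots,f_p(x,u_p))$. $(P_u)$ is the problem of minimizing $f(x,u)$ over $x\in\Omega$, and for an uncertainty set $\mathcal{W}\subseteq(X^* )^p$, $(P_{\mathcal{W}})$ is the family $(P_u)_{u\in\mathcal{W}}$. For $a,b\in\mathbb{R}^p$: $a<b$ iff $a_i<b_i$ for all $i$; $a\leqq b$ iff $a_i\le b_i$ for all $i$. $\bar x\in\Omega$ is a highly robust weakly (resp. strictly) efficient solution of $(P_{\mathcal{W}})$ if for every $u\in\mathcal{W}$ there is no $x\in\Omega\setminus\{\bar x\}$ with $f(x,u)<f(\bar x,u)$ (resp. $f(x,u)\leqq f(\bar x,u)$). $\bar x\in\Omega$ is an isolated efficient solution of $\min f(x)$ s.t. $x\in\Omega$ with constant $c>0$ if $\max_{i\in I}\{f_i(x)-f_i(\bar x)\}\ge c\Vert x-\bar x\Vert$ for all $x\in\Omega$. *)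

theory Defs
  imports "HOL-Analysis.Analysis"
begin

text \<open>The dual of \<open>'a\<close> is \<open>'a \<Rightarrow>\<^sub>L real\<close> with the operator norm; the space \<open>\<real>\<^sup>p\<close> is
  \<open>real ^ 'p\<close>, so that \<open>p = CARD('p)\<close>. An uncertainty set is a set of tuples of functionals.\<close>

definition perturbed ::
  "('a::real_normed_vector \<Rightarrow> real ^ 'p) \<Rightarrow> 'a \<Rightarrow> ('a \<Rightarrow>\<^sub>L real) ^ 'p \<Rightarrow> real ^ 'p" where
  "perturbed f x u = (\<chi> i. f x $ i - blinfun_apply (u $ i) x)"

definition uncertainty_product :: "('p \<Rightarrow> 'b set) \<Rightarrow> ('b ^ 'p) set" where
  "uncertainty_product U = {u. \<forall>i. u $ i \<in> U i}"

text \<open>The library order \<open>\<le>\<close> on \<open>real ^ 'p\<close> is componentwise, but its strict part \<open><\<close> only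
  requires one component to be strictly smaller. Hence a separate relation is needed for strict
  inequality in all components.\<close>

definition strictly_below :: "real ^ 'p \<Rightarrow> real ^ 'p \<Rightarrow> bool" where
  "strictly_below a b \<longleftrightarrow> (\<forall>i. a $ i < b $ i)"

definition highly_robust_weakly_efficient ::
  "('a::real_normed_vector \<Rightarrow> real ^ 'p::finite) \<Rightarrow> 'a set \<Rightarrow> (('a \<Rightarrow>\<^sub>L real) ^ 'p) set \<Rightarrow> 'a \<Rightarrow> bool" where
  "highly_robust_weakly_efficient f \<Omega> W xb \<longleftrightarrow>
     xb \<in> \<Omega> \<and>
     (\<forall>u\<in>W. \<not> (\<exists>x\<in>\<Omega> - {xb}. strictly_below (perturbed f x u) (perturbed f xb u)))"

definition highly_robust_strictly_efficient ::
  "('a::real_normed_vector \<Rightarrow> real ^ 'p::finite) \<Rightarrow> 'a set \<Rightarrow> (('a \<Rightarrow>\<^sub>L real) ^ 'p) set \<Rightarrow> 'a \<Rightarrow> bool" where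
  "highly_robust_strictly_efficient f \<Omega> W xb \<longleftrightarrow>
     xb \<in> \<Omega> \<and>
     (\<forall>u\<in>W. \<not> (\<exists>x\<in>\<Omega> - {xb}. perturbed f x u \<le> perturbed f xb u))"

definition isolated_efficient ::
  "('a::real_normed_vector \<Rightarrow> real ^ 'p::finite) \<Rightarrow> 'a set \<Rightarrow> 'a \<Rightarrow> real \<Rightarrow> bool" where
  "isolated_efficient f \<Omega> xb c \<longleftrightarrow>
     xb \<in> \<Omega> \<and> c > 0 \<and> (\<forall>x\<in>\<Omega>. (MAX i. f x $ i - f xb $ i) \<ge> c * norm (x - xb))"

text \<open>A Banach space is a Hilbert space if its given norm is induced by an inner product, that is,
  if some operation makes the type, with its existing structure, satisfy the axioms of the class
  \<open>real_inner\<close>. Unlike the sort \<open>{real_inner, banach}\<close>, this predicate can serve as a hypothesis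
  on a type of sort \<open>banach\<close>.\<close>

definition hilbert_space :: "'a::banach itself \<Rightarrow> bool" where
  "hilbert_space (_ :: 'a itself) \<longleftrightarrow>
     (\<exists>ip :: 'a \<Rightarrow> 'a \<Rightarrow> real.
        class.real_inner (-) dist norm (+) 0 uminus (*\<^sub>R) sgn uniformity open ip)"

lemma hilbert_space_iff:
  "hilbert_space TYPE('a::banach) \<longleftrightarrow>
     (\<exists>ip :: 'a \<Rightarrow> 'a \<Rightarrow> real.
        (\<forall>x y. ip x y = ip y x) \<and>
        (\<forall>x y z. ip (x + y) z = ip x z + ip y z) \<and>
        (\<forall>r x y. ip (r *\<^sub>R x) y = r * ip x y) \<and>
        (\<forall>x. ip x x = (norm x)\<^sup>2))"
  (is "?H \<longleftrightarrow> (\<exists>ip. ?P ip)")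
proof -
  have base: "class.dist_norm (-) dist (norm :: 'a \<Rightarrow> real)"
      "class.real_vector (+) (0::'a) (-) uminus (*\<^sub>R)"
      "class.sgn_div_norm sgn (norm :: 'a \<Rightarrow> real) (*\<^sub>R)"
      "class.uniformity_dist (dist :: 'a \<Rightarrow> 'a \<Rightarrow> real) uniformity"
      "class.open_uniformity (open :: 'a set \<Rightarrow> bool) uniformity"
    by intro_locales
  have ax: "class.real_inner_axioms norm (+) (0::'a) (*\<^sub>R) ip \<longleftrightarrow> ?P ip"
    for ip :: "'a \<Rightarrow> 'a \<Rightarrow> real"
  proof
    assume "class.real_inner_axioms norm (+) 0 (*\<^sub>R) ip"
    then show "?P ip"
      unfolding class.real_inner_axioms_def by (metis real_sqrt_pow2)
  next
    assume "?P ip"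
    then show "class.real_inner_axioms norm (+) 0 (*\<^sub>R) ip"
      unfolding class.real_inner_axioms_def by (metis norm_eq_zero norm_ge_zero power_eq_0_iff real_sqrt_abs abs_of_nonneg
          zero_le_power2 zero_neq_numeral zero_eq_power2)
  qed
  show ?thesis
    unfolding hilbert_space_def class.real_inner_def using base ax by simp
qed

lemma hilbert_space_real_inner: "hilbert_space TYPE('a::{real_inner, banach})"
  unfolding hilbert_space_iff
  by (intro exI[of _ inner]) (simp add: power2_norm_eq_inner inner_add_left, metis inner_commute)

end

theory Submission
  imports Defs
begin

text \<open>
  Passing from \<open>xb\<close> to \<open>x\<close> changes the \<open>i\<close>-th component of the perturbed objective by
  \<open>f\<^sub>i x - f\<^sub>i xb - \<langle>u\<^sub>i, x - xb\<rangle>\<close>, and for \<open>x \<noteq> xb\<close> the pairing with a functional of norm less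
  than \<open>L\<close> stays strictly below \<open>L * norm (x - xb)\<close>.
  Isolated efficiency with constant \<open>L\<close> says precisely that, for each feasible \<open>x\<close>, some \<open>f\<^sub>i\<close>
  grows by at least this bound. No perturbation from the open ball can compensate that growth,
  which is the first implication.

  For the second implication let isolated efficiency with a constant below \<open>L\<close> fail at \<open>x\<close>.
  Put the same functional in every component: a norming functional of \<open>x - xb\<close> scaled to norm at
  most that constant. It offsets the growth of all the \<open>f\<^sub>i\<close> simultaneously, so \<open>x\<close> is strictly
  better than \<open>xb\<close> in every component of this perturbed problem. In a Hilbert space the norming
  functional is the inner product with the normalized vector (lemma \<open>norming_functional_hilbert\<close>).
\<close>

lemma isolated_efficient_iff_ex_component:
  fixes f :: "'a::real_normed_vector \<Rightarrow> real ^ 'p::finite"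
  shows "isolated_efficient f \<Omega> xb c \<longleftrightarrow>
    xb \<in> \<Omega> \<and> c > 0 \<and> (\<forall>x\<in>\<Omega>. \<exists>i. c * norm (x - xb) \<le> f x $ i - f xb $ i)"
  unfolding isolated_efficient_def by (subst Max_ge_iff) auto

lemma perturbed_le_iff:
  "perturbed f x u $ i \<le> perturbed f y u $ i \<longleftrightarrow> f x $ i - f y $ i \<le> blinfun_apply (u $ i) (x - y)"
  by (auto simp: perturbed_def blinfun.diff_right)

lemma perturbed_less_iff:
  "perturbed f x u $ i < perturbed f y u $ i \<longleftrightarrow> f x $ i - f y $ i < blinfun_apply (u $ i) (x - y)"
  by (auto simp: perturbed_def blinfun.diff_right)

text \<open>The norm is already known to satisfy the triangle inequality, so the Cauchy--Schwarz
  inequality, which bounds the norm of the functional, comes from expanding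
  \<open>(norm (x + y))\<^sup>2 \<le> (norm x + norm y)\<^sup>2\<close>, without the usual discriminant argument.\<close>

lemma norming_functional_hilbert:
  fixes z :: "'a::banach"
  assumes "hilbert_space TYPE('a)"
  obtains v :: "'a \<Rightarrow>\<^sub>L real" where "norm v \<le> 1" "blinfun_apply v z = norm z"
proof -
  obtain ip :: "'a \<Rightarrow> 'a \<Rightarrow> real" where
    sym: "ip x y = ip y x" and
    add: "ip (x + y) w = ip x w + ip y w" and
    scale: "ip (r *\<^sub>R x) y = r * ip x y" and
    norm_sq: "ip x x = (norm x)\<^sup>2" for x y w r
    using assms unfolding hilbert_space_iff by blast
  have add_right: "ip w (x + y) = ip w x + ip w y" for x y w
    using add[of x y w] sym[of w x] sym[of w y] sym[of w "x + y"] by linarith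
  have cs_upper: "ip x y \<le> norm x * norm y" for x y
  proof -
    have "(norm (x + y))\<^sup>2 = ip x x + 2 * ip x y + ip y y"
      unfolding norm_sq[symmetric] by (simp add: add add_right sym[of y x])
    moreover have "(norm (x + y))\<^sup>2 \<le> (norm x + norm y)\<^sup>2"
      by (intro power_mono norm_triangle_ineq) simp
    ultimately show ?thesis
      by (simp add: norm_sq power2_sum)
  qed
  have cs: "\<bar>ip x y\<bar> \<le> norm x * norm y" for x y
    using cs_upper[of x y] cs_upper[of "(-1) *\<^sub>R x" y] unfolding scale by simp
  \<comment> \<open>For \<open>z = 0\<close> the sign is \<open>0\<close>, and the zero functional is norming.\<close>
  define v where "v = Blinfun (\<lambda>y. ip y (sgn z))"
  have bound: "\<bar>ip y (sgn z)\<bar> \<le> norm y * 1" for y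
    by (rule order_trans[OF cs mult_left_mono]) (simp_all add: norm_sgn)
  have "bounded_linear (\<lambda>y. ip y (sgn z))"
    by (rule bounded_linear_intro[of _ 1]) (use bound in \<open>auto simp: add scale\<close>)
  then have v: "blinfun_apply v y = ip y (sgn z)" for y
    by (simp add: v_def bounded_linear_Blinfun_apply)
  show thesis
  proof
    show "norm v \<le> 1"
      by (rule norm_blinfun_bound) (use bound in \<open>auto simp: v mult.commute\<close>)
    show "blinfun_apply v z = norm z"
      unfolding v sym[of z "sgn z"]
      by (simp add: sgn_div_norm scale norm_sq power2_eq_square field_simps)
  qed
qed

lemma isolated_imp_highly_robust_strictly:
  fixes f :: "'a::real_normed_vector \<Rightarrow> real ^ 'p::finite"
  assumes "isolated_efficient f \<Omega> xb L"
  shows "highly_robust_strictly_efficient f \<Omega> (uncertainty_product (\<lambda>i. ball 0 L)) xb"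
proof -
  have False if u: "u \<in> uncertainty_product (\<lambda>i. ball 0 L)" and x: "x \<in> \<Omega>" "x \<noteq> xb"
    and le: "perturbed f x u \<le> perturbed f xb u" for u x
  proof -
    obtain i where "L * norm (x - xb) \<le> f x $ i - f xb $ i"
      using assms x unfolding isolated_efficient_iff_ex_component by blast
    also have "\<dots> \<le> blinfun_apply (u $ i) (x - xb)"
      using le unfolding less_eq_vec_def perturbed_le_iff by blast
    also have "\<dots> \<le> norm (u $ i) * norm (x - xb)"
      using norm_blinfun[of "u $ i" "x - xb"] by simp
    also have "\<dots> < L * norm (x - xb)"
      using u x by (simp add: uncertainty_product_def)
    finally show False by simp
  qed
  then show ?thesis
    using assms unfolding highly_robust_strictly_efficient_def isolated_efficient_def by blast
qed

lemma highly_robust_weakly_imp_isolated: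
  fixes f :: "'a::banach \<Rightarrow> real ^ 'p::finite"
  assumes hilbert: "hilbert_space TYPE('a)"
    and robust: "highly_robust_weakly_efficient f \<Omega> (uncertainty_product \<U>) xb"
    and ball: "\<And>i. ball 0 L \<subseteq> \<U> i"
    and c: "0 < c" "c < L"
  shows "isolated_efficient f \<Omega> xb c"
proof -
  have "\<exists>i. c * norm (x - xb) \<le> f x $ i - f xb $ i" if x: "x \<in> \<Omega>" for x
  proof (rule ccontr)
    assume "\<nexists>i. c * norm (x - xb) \<le> f x $ i - f xb $ i"
    then have small: "f x $ i - f xb $ i < c * norm (x - xb)" for i
      by (meson not_le)
    then have "x \<noteq> xb" by force
    obtain v :: "'a \<Rightarrow>\<^sub>L real" where v: "norm v \<le> 1" "blinfun_apply v (x - xb) = norm (x - xb)"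
      using norming_functional_hilbert[OF hilbert] by blast
    define u :: "('a \<Rightarrow>\<^sub>L real) ^ 'p" where "u = (\<chi> i. c *\<^sub>R v)"
    have "norm (c *\<^sub>R v) < L"
      using le_less_trans[OF mult_left_le[OF v(1)] c(2)] c(1) by simp
    then have "u \<in> uncertainty_product \<U>"
      using ball by (auto simp: uncertainty_product_def u_def subset_iff)
    moreover have "strictly_below (perturbed f x u) (perturbed f xb u)"
      unfolding strictly_below_def perturbed_less_iff
      using small v(2) by (simp add: u_def blinfun.scaleR_left)
    ultimately show False
      using robust x \<open>x \<noteq> xb\<close> unfolding highly_robust_weakly_efficient_def by blast
  qed
  then show ?thesis
    using robust c unfolding isolated_efficient_iff_ex_component highly_robust_weakly_efficient_def
    by blast
qed

theorem theorem14:
  fixes f :: "'a::banach \<Rightarrow> real ^ 'p::finite"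
    and \<Omega> :: "'a set"
    and \<U> :: "'p \<Rightarrow> ('a \<Rightarrow>\<^sub>L real) set"
    and xb :: 'a
    and L :: real
  assumes "CARD('p) \<ge> 2"
    and "\<Omega> \<noteq> {}"
    and "\<And>i. \<U> i \<noteq> {}"
    and "xb \<in> \<Omega>"
    and "L > 0"
    and "\<And>i. ball 0 L \<subseteq> \<U> i"
  shows "(isolated_efficient f \<Omega> xb L \<longrightarrow>
            highly_robust_strictly_efficient f \<Omega> (uncertainty_product (\<lambda>i. ball 0 L)) xb)
       \<and> (hilbert_space TYPE('a) \<and> highly_robust_weakly_efficient f \<Omega> (uncertainty_product \<U>) xb \<longrightarrow>
            (\<forall>L'. 0 < L' \<and> L' < L \<longrightarrow> isolated_efficient f \<Omega> xb L'))"
  using assms(6) isolated_imp_highly_robust_strictly highly_robust_weakly_imp_isolated by blast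

end
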